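(* Consider the conditional expectation of the (discretised) complete-data log-likelihood for interval-censored multi-state data, $$\mathbb{E}[\ell^{\mathrm C}\mid \mathrm O,\widetilde\alpha]=\sum_{k=1}^K\sum_{(g,h)\in\mathcal V}\Big\{\mathbb{E}[d_{gh}^k\mid \mathrm O,\widetilde\alpha]\log(\alpha_{gh}^k)-\alpha_{gh}^k\,\mathbb{E}[Y_g^k\mid \mathrm O,\widetilde\alpha]\Big\}.$$ When no transition times are known exactly, the conditional expectations appearing in it are given, for all $(g,h)\in\mathcal V$ and $k\in\{1,\dots,K\}$, by $$d_{gh}^k(\widetilde\alpha):=\mathbb{E}[d_{gh}^k\mid \mathrm O,\widetilde\alpha]=\sum_{i=1}^n\frac{\widetilde P_{a_i^k,g}(l_i^k,\tau_{k-1})\;\widetilde\alpha_{gh}^k\;\widetilde P_{h,b_i^k}(\tau_k,r_i^k)}{\widetilde P_{a_i^k,b_i^k}(l_i^k,r_i^k)},$$ $$Y_g^k(\widetilde\alpha):=\mathbb{E}[Y_g^k\mid \mathrm O,\widetilde\alpha]=\sum_{i=1}^n\frac{\widetilde P_{a_i^k,g}(l_i^k,\tau_{k-1})\;\widetilde P_{g,b_i^k}(\tau_k-,r_i^k)}{\widetilde P_{a_i^k,b_i^k}(l_i^k,r_i^k)},$$ where $\widetilde{\mathbf P}(s,t)$ is the product integral over $(s,t]$ of the current estimates of the cumulative transition intensities, and $\widetilde P_{g,b}(\tau_k-,t)=\widetilde P_{g,b}(\tau_{k-1},t)$.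
   Context: States and transitions: $\mathcal H=\{1,\dots,H\}$ is a finite state set, and $\mathcal V\subseteq\{(g,h)\in\mathcal H\times\mathcal H: g\ne h\}$ is the set of possible direct transitions. The directed graph $(\mathcal H,\mathcal V)$ is acyclic. Time grid: $0=\tau_0<\tau_1<\dots<\tau_K<\infty$. Parameters: an array $\alpha=(\alpha_{gh}^k)$, $g\neq h\in\mathcal H$, $k=1,\dots,K$, with $\alpha_{gh}^k\ge 0$, $\sum_{h\ne g}\alpha_{gh}^k\le 1$, and $\alpha_{gh}^k=0$ if $(g,h)\notin\mathcal V$. It represents cumulative intensities $A_{gh}$ that are right-continuous step functions jumping only at the $\tau_k$, with jump $\alpha_{gh}^k$ at $\tau_k$. The current estimate $\widetilde\alpha$ is a fixed array satisfying the same constraints, with associated $\widetilde A_{gh}$ and $\widetilde A_{gg}=-\sum_{h\ne g}\widetilde A_{gh}$. Let $\Delta\widetilde{\mathbf A}(\tau_k)$ be the $H\times H$ matrix with off-diagonal entries $\widetilde\alpha_{gh}^k$ and diagonal entries $-\sum_{h\neq g}\widetilde\alpha_{gh}^k$. The product integral is the ordered product (time increasing from left to right) $$\widetilde{\mathbf P}(s,t)=\prod_{k:\,s<\tau_k\le t}\big(\mathbf I+\Delta\widetilde{\mathbf A}(\tau_k)\big),$$ an empty product being $\mathbf I$; its $(g,h)$ entry is $\widetilde P_{g,h}(s,t)$. Processes: under the law given $\widetilde\alpha$, the processes $X_1,\dots,X_n$ are independent Markov processes on $\mathcal H$ with right-continuous piecewise constant paths, changing state only at times $\tau_k$, with $\mathbb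 P(X_i(t)=h\mid X_i(s)=g)=\widetilde P_{g,h}(s,t)$ for grid times $s\le t$. $X_i(\tau_k-)$ is the state just before $\tau_k$, so $X_i(\tau_k-)=X_i(\tau_{k-1})$. Observed data: subject $i$ is observed at times $t_{i0}<t_{i1}<\dots<t_{in_i}$, all in $\{\tau_0,\dots,\tau_K\}$ and treated as fixed (visits are conditionally independent of the process), in states $x_{i0},\dots,x_{in_i}$. $\mathrm O$ denotes the observed data, so conditioning on $\mathrm O$ means conditioning on $X_i(t_{ij})=x_{ij}$ for all $i,j$. This event is assumed to have positive probability under $\widetilde\alpha$. For given $k$ and $i$: $l_i^k=\max\{t_{ij}: t_{ij}\le\tau_{k-1}\}$, $r_i^k=\min\{t_{ij}: t_{ij}\ge\tau_k\}$, and $a_i^k$, $b_i^k$ are the observed states of subject $i$ at $l_i^k$ and $r_i^k$. Counts: $d_{gh,i}^k=\mathbf 1\{X_i(\tau_k-)=g,\ X_i(\tau_k)=h\}$, $Y_{g,i}^k=\mathbf 1\{X_i(\tau_k-)=g\}$, $d_{gh}^k=\sum_{i=1}^n d_{gh,i}^k$, $Y_g^k=\sum_{i=1}^nY_{g,i}^k$. A subject $i$ for which $(\tau_{k-1},\tau_k]$ is not contained in $(t_{i0},t_{in_i}]$ is not under observation in that bin and contributes $0$ to $d_{gh}^k$, to $Y_g^k$ and to the sums in the claim. The discretised complete-data log-likelihood is $\ell^{\mathrm C}=\sum_{k=1}^K\sum_{(g,h)\in\mathcal V}\{d_{gh}^k\log(\alpha_{gh}^k)-\alpha_{gh}^kY_g^k\}$.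 *)

theory Defs
  imports "HOL-Probability.Probability"
begin

text \<open>
  The state set is a finite type \<open>'h\<close>, so \<open>H = CARD('h)\<close>. Arrays \<open>\<alpha> k g h\<close> are only ever
  used for \<open>k \<in> {1..K}\<close> and \<open>g \<noteq> h\<close>; values elsewhere are irrelevant.
\<close>

definition time_grid :: "nat \<Rightarrow> (nat \<Rightarrow> real) \<Rightarrow> bool" where
  "time_grid K \<tau> \<longleftrightarrow> \<tau> 0 = 0 \<and> strict_mono_on {0..K} \<tau>"

definition intensity_array ::
  "nat \<Rightarrow> ('h::finite \<times> 'h) set \<Rightarrow> (nat \<Rightarrow> 'h \<Rightarrow> 'h \<Rightarrow> real) \<Rightarrow> bool" where
  "intensity_array K V \<alpha> \<longleftrightarrow>
     (\<forall>k\<in>{1..K}. (\<forall>g h. g \<noteq> h \<longrightarrow> 0 \<le> \<alpha> k g h) \<and>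
                (\<forall>g. (\<Sum>h\<in>UNIV - {g}. \<alpha> k g h) \<le> 1) \<and>
                (\<forall>g h. g \<noteq> h \<longrightarrow> (g, h) \<notin> V \<longrightarrow> \<alpha> k g h = 0))"

definition increment_matrix ::
  "(nat \<Rightarrow> 'h::finite \<Rightarrow> 'h \<Rightarrow> real) \<Rightarrow> nat \<Rightarrow> real^'h^'h" where
  "increment_matrix \<alpha> k =
     (\<chi> g h. if g = h then - (\<Sum>h'\<in>UNIV - {g}. \<alpha> k g h') else \<alpha> k g h)"

definition product_integral ::
  "nat \<Rightarrow> (nat \<Rightarrow> real) \<Rightarrow> (nat \<Rightarrow> 'h::finite \<Rightarrow> 'h \<Rightarrow> real) \<Rightarrow> real \<Rightarrow> real \<Rightarrow> real^'h^'h" where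
  "product_integral K \<tau> \<alpha> s t =
     foldr (\<lambda>k B. (mat 1 + increment_matrix \<alpha> k) ** B)
       (filter (\<lambda>k. s < \<tau> k \<and> \<tau> k \<le> t) [1..<Suc K]) (mat 1)"

text \<open>The left limit in the first time argument, usually written \<open>P(u-, t)\<close>.\<close>

definition product_integral_left ::
  "nat \<Rightarrow> (nat \<Rightarrow> real) \<Rightarrow> (nat \<Rightarrow> 'h::finite \<Rightarrow> 'h \<Rightarrow> real) \<Rightarrow> real \<Rightarrow> real \<Rightarrow> real^'h^'h" where
  "product_integral_left K \<tau> \<alpha> u t = Lim (at_left u) (\<lambda>s. product_integral K \<tau> \<alpha> s t)"

text \<open>Processes have time set \<open>{0..}\<close>.\<close>

definition markov_process :: "'w measure \<Rightarrow> (real \<Rightarrow> 'w \<Rightarrow> 'h::finite) \<Rightarrow> bool" where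
  "markov_process M X \<longleftrightarrow>
     (\<forall>t\<ge>0. X t \<in> measurable M (count_space UNIV)) \<and>
     (\<forall>(m::nat) s y. 0 \<le> s 0 \<longrightarrow> strict_mono_on {0..Suc m} s \<longrightarrow>
        \<P>(\<omega> in M. \<forall>j\<le>m. X (s j) \<omega> = y j) > 0 \<longrightarrow>
        \<P>(\<omega> in M. X (s (Suc m)) \<omega> = y (Suc m) \<bar> \<forall>j\<le>m. X (s j) \<omega> = y j) =
        \<P>(\<omega> in M. X (s (Suc m)) \<omega> = y (Suc m) \<bar> X (s m) \<omega> = y m))"

text \<open>
  Right-continuous piecewise constant paths that change state only at grid times: constant on
  each \<open>[\<tau> k, \<tau> (k + 1))\<close>, and on \<open>[\<tau> K, \<infinity>)\<close>.
\<close>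

definition grid_step_path :: "nat \<Rightarrow> (nat \<Rightarrow> real) \<Rightarrow> (real \<Rightarrow> 'h) \<Rightarrow> bool" where
  "grid_step_path K \<tau> x \<longleftrightarrow>
     (\<forall>k\<le>K. \<forall>t. \<tau> k \<le> t \<longrightarrow> (k < K \<longrightarrow> t < \<tau> (Suc k)) \<longrightarrow> x t = x (\<tau> k))"

definition has_grid_transitions ::
  "'w measure \<Rightarrow> nat \<Rightarrow> (nat \<Rightarrow> real) \<Rightarrow> (real \<Rightarrow> real \<Rightarrow> real^'h^'h) \<Rightarrow>
   (real \<Rightarrow> 'w \<Rightarrow> 'h::finite) \<Rightarrow> bool" where
  "has_grid_transitions M K \<tau> P X \<longleftrightarrow>
     (\<forall>s\<in>\<tau> ` {0..K}. \<forall>t\<in>\<tau> ` {0..K}. \<forall>g h. s \<le> t \<longrightarrow>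
        \<P>(\<omega> in M. X s \<omega> = g) > 0 \<longrightarrow>
        \<P>(\<omega> in M. X t \<omega> = h \<bar> X s \<omega> = g) = P s t $ g $ h)"

text \<open>Independence of whole processes, as random elements of the product space over \<open>{0..}\<close>.\<close>

definition independent_processes ::
  "'w measure \<Rightarrow> nat set \<Rightarrow> (nat \<Rightarrow> real \<Rightarrow> 'w \<Rightarrow> 'h) \<Rightarrow> bool" where
  "independent_processes M I X \<longleftrightarrow>
     prob_space.indep_vars M (\<lambda>_. PiM {0..} (\<lambda>_. count_space UNIV))
       (\<lambda>i \<omega>. \<lambda>t\<in>{0..}. X i t \<omega>) I"

definition state_before :: "(real \<Rightarrow> 'w \<Rightarrow> 'h) \<Rightarrow> real \<Rightarrow> 'w \<Rightarrow> 'h" where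
  "state_before X u \<omega> = (THE h. \<forall>\<^sub>F s in at_left u. X s \<omega> = h)"

text \<open>
  A visit scheme of one subject consists of the index \<open>m\<close> of the last visit, the visit times
  \<open>v 0 < \<dots> < v m\<close> and the states \<open>x 0, \<dots>, x m\<close> seen there.
\<close>

definition visit_scheme :: "nat \<Rightarrow> (nat \<Rightarrow> real) \<Rightarrow> nat \<Rightarrow> (nat \<Rightarrow> real) \<Rightarrow> bool" where
  "visit_scheme K \<tau> m v \<longleftrightarrow> strict_mono_on {0..m} v \<and> v ` {0..m} \<subseteq> \<tau> ` {0..K}"

definition last_visit :: "nat \<Rightarrow> (nat \<Rightarrow> real) \<Rightarrow> real \<Rightarrow> real" where
  "last_visit m v u = Max {v j | j. j \<le> m \<and> v j \<le> u}"

definition next_visit :: "nat \<Rightarrow> (nat \<Rightarrow> real) \<Rightarrow> real \<Rightarrow> real" where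
  "next_visit m v u = Min {v j | j. j \<le> m \<and> u \<le> v j}"

definition visit_state :: "nat \<Rightarrow> (nat \<Rightarrow> real) \<Rightarrow> (nat \<Rightarrow> 'h) \<Rightarrow> real \<Rightarrow> 'h" where
  "visit_state m v x u = x (THE j. j \<le> m \<and> v j = u)"

definition observed_event ::
  "'w measure \<Rightarrow> nat \<Rightarrow> (nat \<Rightarrow> nat) \<Rightarrow> (nat \<Rightarrow> nat \<Rightarrow> real) \<Rightarrow> (nat \<Rightarrow> nat \<Rightarrow> 'h) \<Rightarrow>
   (nat \<Rightarrow> real \<Rightarrow> 'w \<Rightarrow> 'h) \<Rightarrow> 'w set" where
  "observed_event M n m v x X =
     {\<omega> \<in> space M. \<forall>i\<in>{1..n}. \<forall>j\<le>m i. X i (v i j) \<omega> = x i j}"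

text \<open>The subjects that are under observation in the bin \<open>(\<tau> (k - 1), \<tau> k]\<close>.\<close>

definition under_observation ::
  "(nat \<Rightarrow> real) \<Rightarrow> nat \<Rightarrow> (nat \<Rightarrow> nat) \<Rightarrow> (nat \<Rightarrow> nat \<Rightarrow> real) \<Rightarrow> nat \<Rightarrow> nat set" where
  "under_observation \<tau> n m v k =
     {i \<in> {1..n}. {\<tau> (k - 1)<..\<tau> k} \<subseteq> {v i 0<..v i (m i)}}"

definition transition_count ::
  "(nat \<Rightarrow> real) \<Rightarrow> nat \<Rightarrow> (nat \<Rightarrow> nat) \<Rightarrow> (nat \<Rightarrow> nat \<Rightarrow> real) \<Rightarrow> (nat \<Rightarrow> real \<Rightarrow> 'w \<Rightarrow> 'h) \<Rightarrow>
   nat \<Rightarrow> 'h \<Rightarrow> 'h \<Rightarrow> 'w \<Rightarrow> real" where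
  "transition_count \<tau> n m v X k g h \<omega> =
     (\<Sum>i\<in>under_observation \<tau> n m v k.
        of_bool (state_before (X i) (\<tau> k) \<omega> = g \<and> X i (\<tau> k) \<omega> = h))"

definition at_risk_count ::
  "(nat \<Rightarrow> real) \<Rightarrow> nat \<Rightarrow> (nat \<Rightarrow> nat) \<Rightarrow> (nat \<Rightarrow> nat \<Rightarrow> real) \<Rightarrow> (nat \<Rightarrow> real \<Rightarrow> 'w \<Rightarrow> 'h) \<Rightarrow>
   nat \<Rightarrow> 'h \<Rightarrow> 'w \<Rightarrow> real" where
  "at_risk_count \<tau> n m v X k g \<omega> =
     (\<Sum>i\<in>under_observation \<tau> n m v k. of_bool (state_before (X i) (\<tau> k) \<omega> = g))"

text \<open>
  The log-likelihood is extended-real valued because \<open>\<alpha> k g h = 0\<close> is allowed on \<open>V\<close>: there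
  \<open>log 0 = -\<infinity>\<close>, and the library's \<open>0 * (-\<infinity>) = 0\<close> is the usual convention for \<open>0 log 0\<close>.
\<close>

definition log_ereal :: "real \<Rightarrow> ereal" where
  "log_ereal a = (if a = 0 then -\<infinity> else ereal (ln a))"

definition complete_log_likelihood ::
  "nat \<Rightarrow> ('h::finite \<times> 'h) set \<Rightarrow> (nat \<Rightarrow> real) \<Rightarrow> nat \<Rightarrow> (nat \<Rightarrow> nat) \<Rightarrow> (nat \<Rightarrow> nat \<Rightarrow> real) \<Rightarrow>
   (nat \<Rightarrow> real \<Rightarrow> 'w \<Rightarrow> 'h) \<Rightarrow> (nat \<Rightarrow> 'h \<Rightarrow> 'h \<Rightarrow> real) \<Rightarrow> 'w \<Rightarrow> ereal" where
  "complete_log_likelihood K V \<tau> n m v X \<alpha> \<omega> =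
     (\<Sum>k\<in>{1..K}. \<Sum>(g, h)\<in>V.
        ereal (transition_count \<tau> n m v X k g h \<omega>) * log_ereal (\<alpha> k g h)
          - ereal (\<alpha> k g h * at_risk_count \<tau> n m v X k g \<omega>))"

text \<open>Expectations given an event \<open>A\<close> of positive probability.\<close>

definition event_expectation :: "'w measure \<Rightarrow> 'w set \<Rightarrow> ('w \<Rightarrow> real) \<Rightarrow> real" where
  "event_expectation M A f = integral\<^sup>L (uniform_measure M A) f"

definition event_expectation_ereal :: "'w measure \<Rightarrow> 'w set \<Rightarrow> ('w \<Rightarrow> ereal) \<Rightarrow> ereal" where
  "event_expectation_ereal M A f =
     enn2ereal (\<integral>\<^sup>+\<omega>. e2ennreal (f \<omega>) \<partial>uniform_measure M A)
       - enn2ereal (\<integral>\<^sup>+\<omega>. e2ennreal (- f \<omega>) \<partial>uniform_measure M A)"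

end

theory Submission
  imports Defs
begin

text \<open>
  By the Markov property, the probability that one subject runs through given states at given grid
  times is an initial probability times a product of entries of \<open>P\<close>, and \<open>P t t = mat 1\<close> makes this
  true for repeated times as well. Conditioning on the visits, independence cancels
  all other subjects, and inserting the states at \<open>\<tau> (k - 1)\<close> and \<open>\<tau> k\<close> between the two visits that
  surround the bin changes a single factor of the product. The expected
  log-likelihood follows by linearity, since all its terms are nonpositive.
\<close>

section \<open>Probabilities of finitely many grid states of one subject\<close>

text \<open>Only the set of pairs matters here, so entries may be reordered or repeated, and
  contradictory entries yield the empty event. The list form carries the order in time that
  \<open>path_weight\<close> reads.\<close>

definition path_event :: "'w measure \<Rightarrow> (real \<Rightarrow> 'w \<Rightarrow> 'h) \<Rightarrow> (real \<times> 'h) list \<Rightarrow> 'w set" where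
  "path_event M X L = {\<omega> \<in> space M. \<forall>(t, y)\<in>set L. X t \<omega> = y}"

text \<open>The law of the first state is deliberately left out: it enters as a separate factor,
  which cancels in conditional probabilities.\<close>

fun path_weight :: "(real \<Rightarrow> real \<Rightarrow> real^'h^'h) \<Rightarrow> (real \<times> 'h::finite) list \<Rightarrow> real" where
  "path_weight P ((s, g) # (t, h) # L) = P s t $ g $ h * path_weight P ((t, h) # L)"
| "path_weight P _ = 1"

text \<open>Factors belong to adjacent pairs, so cutting a path must keep the cut point
  \<open>p\<close> on both sides.\<close>

lemma path_weight_append:
  "path_weight P (L @ p # L') = path_weight P (L @ [p]) * path_weight P (p # L')"
proof (induction L)
  case Nil
  then show ?case by (cases p) simp
next
  case (Cons q L)
  then show ?case by (cases L; cases q; cases p) auto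
qed

lemma path_event_sets:
  assumes "\<And>t. 0 \<le> t \<Longrightarrow> X t \<in> measurable M (count_space UNIV)" and "fst ` set L \<subseteq> {0..}"
  shows "path_event M X L \<in> sets M"
proof -
  have "{\<omega> \<in> space M. X t \<omega> = y} \<in> sets M" if "(t, y) \<in> set L" for t y
  proof -
    have "0 \<le> t" using assms(2) that by force
    with assms(1) have "X t -` {y} \<inter> space M \<in> sets M" by (auto intro: measurable_sets)
    then show ?thesis by (simp add: vimage_def Int_def conj_commute)
  qed
  then show ?thesis unfolding path_event_def by (intro sets.sets_Collect_finite_All) auto
qed

lemma sorted_map_fst_le_last:
  assumes "sorted (map fst L)" "q \<in> set L"
  shows "fst q \<le> fst (last L)"
proof -
  have "L \<noteq> []" using assms(2) by auto
  then obtain L' p where L: "L = L' @ [p]" by (metis rev_exhaust)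
  show ?thesis using assms unfolding L by (auto simp: sorted_append)
qed

lemma prob_path_event_snoc:
  fixes X :: "real \<Rightarrow> 'w \<Rightarrow> 'h::finite"
  assumes "prob_space M" and mk: "markov_process M X" and tr: "has_grid_transitions M K \<tau> P X"
    and Pid: "\<And>t. P t t = mat 1" and pos: "\<tau> ` {0..K} \<subseteq> {0..}"
    and L: "L \<noteq> []" "sorted (map fst L)" "fst ` set L \<subseteq> \<tau> ` {0..K}"
    and t: "t \<in> \<tau> ` {0..K}" "fst (last L) \<le> t"
  shows "measure M (path_event M X (L @ [(t, h)])) =
    measure M (path_event M X L) * P (fst (last L)) t $ snd (last L) $ h"
proof -
  interpret prob_space M by fact
  obtain u g where last: "last L = (u, g)" by fastforce
  have ug: "(u, g) \<in> set L" using L(1) last last_in_set by metis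
  have meas: "X s \<in> measurable M (count_space UNIV)" if "0 \<le> s" for s
    using mk that by (simp add: markov_process_def)
  have Lpos: "fst ` set L \<subseteq> {0..}" using L(3) pos by blast
  note sts = path_event_sets[OF meas Lpos]
  have snoc: "path_event M X (L @ [(t, h)]) = {\<omega> \<in> path_event M X L. X t \<omega> = h}"
    by (auto simp: path_event_def)
  consider "t = u" | "measure M (path_event M X L) = 0" | "u < t" "prob (path_event M X L) > 0"
    using t(2) last by (auto simp: zero_less_measure_iff order_le_less)
  then show ?thesis
  proof cases
    case 1
    have "path_event M X (L @ [(t, h)]) = (if g = h then path_event M X L else {})"
      using ug 1 unfolding snoc by (auto simp: path_event_def)
    then show ?thesis using 1 last by (simp add: Pid mat_def)
  next
    case 2
    have "measure M (path_event M X (L @ [(t, h)])) \<le> measure M (path_event M X L)"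
      by (intro finite_measure_mono sts) (auto simp: snoc)
    with 2 show ?thesis using measure_nonneg[of M "path_event M X (L @ [(t, h)])"] by simp
  next
    case 3
    then obtain \<omega>0 where w0: "\<omega>0 \<in> path_event M X L" by fastforce
    define T where "T = fst ` set L"
    define ls where "ls = sorted_list_of_set T"
    have fT: "finite T" "T \<noteq> {}" using L(1) by (auto simp: T_def)
    have ls: "sorted_wrt (<) ls" "set ls = T" unfolding ls_def using fT by auto
    \<comment> \<open>The past in \<open>markov_process\<close> is indexed from 0, so its last index
      is one less than the number of distinct times.\<close>
    define p where "p = length ls - 1"
    have "ls \<noteq> []" using ls fT by auto
    then have len: "length ls = Suc p" by (cases ls) (auto simp: p_def)
    have uT: "u \<in> T" using ug by (force simp: T_def)
    have umax: "s \<le> u" if "s \<in> T" for s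
      using that sorted_map_fst_le_last[OF L(2)] last by (force simp: T_def)
    have nthls: "ls ! i < ls ! j" if "i < j" "j \<le> p" for i j
      using ls(1) that len sorted_wrt_nth_less by fastforce
    have nthT: "ls ! j \<in> T" if "j \<le> p" for j
      using ls(2) len that nth_mem[of j ls] by auto
    have T_ex: "\<exists>j\<le>p. s = ls ! j" if "s \<in> T" for s
      using that len unfolding ls(2)[symmetric] in_set_conv_nth by (metis less_Suc_eq_le)
    have lsp: "ls ! p = u"
    proof (rule antisym)
      show "ls ! p \<le> u" using umax nthT by auto
      obtain j where "j \<le> p" "u = ls ! j" using T_ex uT by blast
      then show "u \<le> ls ! p" using nthls[of j p] by (cases "j = p") auto
    qed
    text \<open>The list \<open>L\<close> may repeat times, but its event contains a point \<open>\<omega>0\<close>: the states at the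
      distinct times \<open>ls\<close> are read off there.\<close>
    define s where "s j = (if j \<le> p then ls ! j else t)" for j
    define y where "y j = (if j \<le> p then X (s j) \<omega>0 else h)" for j
    have "strict_mono_on {0..Suc p} s"
    proof (rule strict_mono_onI)
      fix i j assume "i \<in> {0..Suc p}" "j \<in> {0..Suc p}" "i < j"
      then show "s i < s j"
        using nthls[of i j] umax[OF nthT[of i]] 3(1) by (auto simp: s_def)
    qed
    moreover have "0 \<le> s 0" using nthT[of 0] Lpos by (auto simp: s_def T_def)
    moreover have ev: "{\<omega> \<in> space M. \<forall>j\<le>p. X (s j) \<omega> = y j} = path_event M X L"
    proof -
      have "(\<forall>j\<le>p. X (s j) \<omega> = y j) \<longleftrightarrow> (\<forall>r\<in>T. X r \<omega> = X r \<omega>0)" for \<omega>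
        using T_ex nthT by (fastforce simp: s_def y_def)
      moreover have "(\<forall>r\<in>T. X r \<omega> = X r \<omega>0) \<longleftrightarrow> (\<forall>(r, z)\<in>set L. X r \<omega> = z)" for \<omega>
        using w0 by (fastforce simp: T_def path_event_def)
      ultimately show ?thesis by (simp add: path_event_def)
    qed
    ultimately have "\<P>(\<omega> in M. X (s (Suc p)) \<omega> = y (Suc p) \<bar> \<forall>j\<le>p. X (s j) \<omega> = y j) =
        \<P>(\<omega> in M. X (s (Suc p)) \<omega> = y (Suc p) \<bar> X (s p) \<omega> = y p)"
      using mk 3(2) unfolding markov_process_def by auto
    moreover have "y p = g" using w0 ug lsp by (auto simp: y_def s_def path_event_def)
    ultimately have eq: "\<P>(\<omega> in M. X t \<omega> = h \<bar> \<forall>j\<le>p. X (s j) \<omega> = y j) =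
        \<P>(\<omega> in M. X t \<omega> = h \<bar> X u \<omega> = g)"
      by (simp add: s_def y_def lsp)
    have u0: "0 \<le> u" using uT Lpos by (auto simp: T_def)
    \<comment> \<open>\<open>has_grid_transitions\<close> speaks only of states of positive
      probability; the state \<open>g\<close> at \<open>u\<close> qualifies because it contains the
      whole past event.\<close>
    have "path_event M X L \<subseteq> {\<omega> \<in> space M. X u \<omega> = g}" using ug by (auto simp: path_event_def)
    moreover have "path_event M X [(u, g)] = {\<omega> \<in> space M. X u \<omega> = g}"
      by (simp add: path_event_def)
    then have "{\<omega> \<in> space M. X u \<omega> = g} \<in> sets M"
      using path_event_sets[where L="[(u, g)]" and M=M and X=X] meas u0 by simp
    ultimately have "\<P>(\<omega> in M. X u \<omega> = g) > 0"
      using 3(2) finite_measure_mono by (smt (verit))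
    moreover have "u \<in> \<tau> ` {0..K}" using uT L(3) by (auto simp: T_def)
    ultimately have "\<P>(\<omega> in M. X t \<omega> = h \<bar> X u \<omega> = g) = P u t $ g $ h"
      using tr t(1) 3(1) unfolding has_grid_transitions_def by (meson less_imp_le)
    moreover have "{\<omega> \<in> space M. X t \<omega> = h \<and> (\<forall>j\<le>p. X (s j) \<omega> = y j)} =
        path_event M X (L @ [(t, h)])"
      unfolding snoc ev[symmetric] by auto
    ultimately show ?thesis
      using eq ev 3(2) last by (simp add: cond_prob_def field_simps)
  qed
qed

text \<open>The one-step result is iterated. Induction runs from the right end because the Markov
  property adds the latest time.\<close>

lemma prob_path_event:
  fixes X :: "real \<Rightarrow> 'w \<Rightarrow> 'h::finite"
  assumes "prob_space M" "markov_process M X" "has_grid_transitions M K \<tau> P X"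
    and "\<And>t. P t t = mat 1" "\<tau> ` {0..K} \<subseteq> {0..}"
    and "sorted (map fst (p # L))" "fst ` set (p # L) \<subseteq> \<tau> ` {0..K}"
  shows "measure M (path_event M X (p # L)) =
    measure M (path_event M X [p]) * path_weight P (p # L)"
  using assms(6,7)
proof (induction L rule: rev_induct)
  case Nil
  then show ?case by (cases p) simp
next
  case (snoc q L)
  obtain t h where q: "q = (t, h)" by fastforce
  obtain L0 u g where Lu: "p # L = L0 @ [(u, g)]" by (metis append_butlast_last_id list.distinct(1) prod.exhaust)
  have s: "sorted (map fst (p # L))" "fst (last (p # L)) \<le> t"
    using snoc.prems(1) unfolding q by (auto simp: sorted_append)
  have "measure M (path_event M X ((p # L) @ [(t, h)])) =
      measure M (path_event M X (p # L)) * P (fst (last (p # L))) t $ snd (last (p # L)) $ h"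
    using snoc.prems(2) q by (intro prob_path_event_snoc[OF assms(1-5)] s) auto
  also have "measure M (path_event M X (p # L)) =
      measure M (path_event M X [p]) * path_weight P (p # L)"
    using snoc.prems(2) by (intro snoc.IH s) auto
  also have "\<dots> * P (fst (last (p # L))) t $ snd (last (p # L)) $ h =
      measure M (path_event M X [p]) * path_weight P ((p # L) @ [q])"
    unfolding Lu q using path_weight_append[of P L0 "(u, g)" "[(t, h)]"] by simp
  finally show ?case by (simp add: q)
qed

text \<open>Numerator and denominator share the law of the first state, the weight up to
  \<open>p\<close> and the weight from \<open>q\<close> on. All of these are nonzero by
  \<open>pos\<close> and cancel, leaving only the stretch between \<open>p\<close> and
  \<open>q\<close>.\<close>

lemma prob_path_event_insert:
  fixes X :: "real \<Rightarrow> 'w \<Rightarrow> 'h::finite"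
  assumes M: "prob_space M" "markov_process M X" "has_grid_transitions M K \<tau> P X"
      "\<And>t. P t t = mat 1" "\<tau> ` {0..K} \<subseteq> {0..}"
    and L: "sorted (map fst (L1 @ p # L @ q # L2))" "fst ` set (L1 @ p # L @ q # L2) \<subseteq> \<tau> ` {0..K}"
    and pos: "measure M (path_event M X (L1 @ p # q # L2)) > 0"
  shows "measure M (path_event M X (L1 @ p # L @ q # L2)) / measure M (path_event M X (L1 @ p # q # L2))
    = path_weight P (p # L @ [q]) / path_weight P [p, q]"
proof -
  \<comment> \<open>The earliest point is the head of \<open>L1\<close>, or \<open>p\<close> itself
    if \<open>L1\<close> is empty.\<close>
  obtain z Z where z: "L1 @ [p] = z # Z" by (cases L1) auto
  \<comment> \<open>The factorization serves twice: with \<open>N\<close> equal to \<open>L\<close>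
    for the numerator and with the empty list for the denominator.\<close>
  have gen: "measure M (path_event M X (L1 @ p # N @ q # L2)) =
      measure M (path_event M X [z]) * path_weight P (L1 @ [p]) * path_weight P (p # N @ [q])
        * path_weight P (q # L2)"
    if "sorted (map fst (L1 @ p # N @ q # L2))" "fst ` set (L1 @ p # N @ q # L2) \<subseteq> \<tau> ` {0..K}" for N
  proof -
    have e: "L1 @ p # N @ q # L2 = z # (Z @ N @ q # L2)"
      using z by (metis append_Cons append_assoc append_Nil)
    have "path_weight P (L1 @ p # N @ q # L2) =
        path_weight P (L1 @ [p]) * path_weight P (p # N @ [q]) * path_weight P (q # L2)"
      using path_weight_append[of P L1 p "N @ q # L2"] path_weight_append[of P "p # N" q L2] by simp
    with prob_path_event[OF M, where p=z and L="Z @ N @ q # L2"] that show ?thesis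
      unfolding e by (simp add: mult.assoc)
  qed
  have "sorted (map fst (L1 @ p # [] @ q # L2))" "fst ` set (L1 @ p # [] @ q # L2) \<subseteq> \<tau> ` {0..K}"
    using L by (auto simp: sorted_append)
  note g0 = gen[OF this]
  show ?thesis using pos unfolding gen[OF L] g0[simplified]
    by (auto simp: zero_less_mult_iff)
qed

section \<open>Expectations given an event\<close>

lemma integrable_sum_of_bool:
  fixes Q :: "'i \<Rightarrow> 'w \<Rightarrow> bool"
  assumes "finite_measure M" and Q: "\<And>i. i \<in> I \<Longrightarrow> {\<omega> \<in> space M. Q i \<omega>} \<in> sets M"
  shows "integrable M (\<lambda>\<omega>. \<Sum>i\<in>I. of_bool (Q i \<omega>) :: real)"
proof (rule Bochner_Integration.integrable_sum)
  fix i assume "i \<in> I"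
  interpret finite_measure M by fact
  have "integrable M (indicator {\<omega> \<in> space M. Q i \<omega>} :: 'w \<Rightarrow> real)"
    using Q[OF \<open>i \<in> I\<close>] by (intro integrable_real_indicator) (auto simp: emeasure_eq_measure)
  then show "integrable M (\<lambda>\<omega>. of_bool (Q i \<omega>) :: real)"
    by (rule Bochner_Integration.integrable_cong[THEN iffD1, rotated -1]) (auto simp: indicator_def)
qed

text \<open>Linearity reduces the expected counts to one conditional probability per
  subject.\<close>

lemma event_expectation_sum_of_bool:
  fixes Q :: "'i \<Rightarrow> 'w \<Rightarrow> bool"
  assumes "prob_space M" "A \<in> sets M" "measure M A > 0"
    and Q: "\<And>i. i \<in> I \<Longrightarrow> {\<omega> \<in> space M. Q i \<omega>} \<in> sets M"
  shows "event_expectation M A (\<lambda>\<omega>. \<Sum>i\<in>I. of_bool (Q i \<omega>)) =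
    (\<Sum>i\<in>I. measure M (A \<inter> {\<omega> \<in> space M. Q i \<omega>}) / measure M A)"
proof -
  interpret prob_space M by fact
  have em: "emeasure M A \<noteq> 0" "emeasure M A \<noteq> \<infinity>"
    using assms(3) by (auto simp: emeasure_eq_measure)
  interpret U: prob_space "uniform_measure M A" by (intro prob_space_uniform_measure em)
  have "event_expectation M A (\<lambda>\<omega>. \<Sum>i\<in>I. of_bool (Q i \<omega>)) =
      (\<integral>\<omega>. (\<Sum>i\<in>I. indicator {\<omega> \<in> space M. Q i \<omega>} \<omega>) \<partial>uniform_measure M A)"
    unfolding event_expectation_def
    by (intro Bochner_Integration.integral_cong refl sum.cong) (auto simp: indicator_def)
  also have "\<dots> = (\<Sum>i\<in>I. \<integral>\<omega>. indicator {\<omega> \<in> space M. Q i \<omega>} \<omega> \<partial>uniform_measure M A)"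
    using Q by (intro Bochner_Integration.integral_sum integrable_real_indicator) (auto simp: U.emeasure_eq_measure)
  also have "\<dots> = (\<Sum>i\<in>I. measure M (A \<inter> {\<omega> \<in> space M. Q i \<omega>}) / measure M A)"
  proof (intro sum.cong refl)
    fix i assume "i \<in> I"
    then show "(\<integral>\<omega>. indicator {\<omega> \<in> space M. Q i \<omega>} \<omega> \<partial>uniform_measure M A) =
        measure M (A \<inter> {\<omega> \<in> space M. Q i \<omega>}) / measure M A"
      using Q by (subst Bochner_Integration.integral_indicator)
        (auto simp: measure_uniform_measure[OF em] intro!: arg_cong[where f="measure _"])
  qed
  finally show ?thesis .
qed

text \<open>Every summand is nonpositive, so the positive part of the log-likelihood has integral \<open>0\<close> and
  its negative part is a sum of nonnegative functions, possibly with infinite coefficients.\<close>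

lemma event_expectation_ereal_nonpos_sum:
  fixes D Y :: "'j \<Rightarrow> 'w \<Rightarrow> real" and c :: "'j \<Rightarrow> ereal" and d :: "'j \<Rightarrow> real"
  assumes "prob_space M" "A \<in> sets M" "measure M A > 0" "finite J"
    and c: "\<And>j. j \<in> J \<Longrightarrow> c j \<le> 0" and d: "\<And>j. j \<in> J \<Longrightarrow> 0 \<le> d j"
    and D: "\<And>j \<omega>. 0 \<le> D j \<omega>" "\<And>j. j \<in> J \<Longrightarrow> integrable (uniform_measure M A) (D j)"
    and Y: "\<And>j \<omega>. 0 \<le> Y j \<omega>" "\<And>j. j \<in> J \<Longrightarrow> integrable (uniform_measure M A) (Y j)"
  shows "event_expectation_ereal M A (\<lambda>\<omega>. \<Sum>j\<in>J. ereal (D j \<omega>) * c j - ereal (d j * Y j \<omega>)) =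
    (\<Sum>j\<in>J. ereal (event_expectation M A (D j)) * c j - ereal (d j * event_expectation M A (Y j)))"
proof -
  let ?U = "uniform_measure M A"
  \<comment> \<open>Needed pointwise, with the values of \<open>D\<close> and \<open>Y\<close>, and
    again with their expectations in place of these values. An infinite coefficient, as arises from
    log 0, survives in \<open>e2ennreal (- c j)\<close>.\<close>
  have neg: "- (\<Sum>j\<in>J. ereal (p j) * c j - ereal (d j * q j)) =
      enn2ereal (\<Sum>j\<in>J. e2ennreal (- c j) * ennreal (p j) + ennreal (d j) * ennreal (q j))"
    if p: "\<And>j. 0 \<le> p j" and q: "\<And>j. 0 \<le> q j" for p q :: "'j \<Rightarrow> real"
  proof -
    have t: "- (ereal (p j) * c j - ereal (d j * q j)) =
       enn2ereal (e2ennreal (- c j) * ennreal (p j) + ennreal (d j) * ennreal (q j))" if "j \<in> J" for j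
    proof -
      have "enn2ereal (e2ennreal (- c j) * ennreal (p j)) = (- c j) * ereal (p j)"
        using c[OF that] p[of j] by (simp add: times_ennreal.rep_eq enn2ereal_e2ennreal ereal_0_le_uminus_iff)
      moreover have "enn2ereal (ennreal (d j) * ennreal (q j)) = ereal (d j * q j)"
        using d[OF that] q[of j] by (simp add: times_ennreal.rep_eq)
      ultimately show ?thesis
        by (cases "c j") (auto simp: plus_ennreal.rep_eq mult.commute)
    qed
    \<comment> \<open>Negation passes through a sum of extended reals once \<infinity> and
      -\<infinity> cannot meet; ruling out \<infinity> among the terms suffices.\<close>
    have np: "ereal (p j) * c j - ereal (d j * q j) \<noteq> \<infinity>" if "j \<in> J" for j
    proof
      assume *: "ereal (p j) * c j - ereal (d j * q j) = \<infinity>"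
      have "0 \<le> - (ereal (p j) * c j - ereal (d j * q j))" unfolding t[OF that] by simp
      then show False unfolding * by simp
    qed
    have "- (\<Sum>j\<in>J. ereal (p j) * c j - ereal (d j * q j)) =
        (\<Sum>j\<in>J. - (ereal (p j) * c j - ereal (d j * q j)))"
      using \<open>finite J\<close> np
    proof (induction J rule: finite_induct)
      case (insert j F)
      then have "(\<Sum>j\<in>F. ereal (p j) * c j - ereal (d j * q j)) \<noteq> \<infinity>"
        by (auto simp: sum_Pinfty)
      moreover have "(\<Sum>j\<in>F. - (ereal (p j) * c j - ereal (d j * q j))) =
          - (\<Sum>j\<in>F. ereal (p j) * c j - ereal (d j * q j))"
        using insert by simp
      ultimately show ?case
        unfolding sum.insert[OF insert.hyps] using insert.prems[of j]
        by (cases "ereal (p j) * c j - ereal (d j * q j)";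
            cases "\<Sum>j\<in>F. ereal (p j) * c j - ereal (d j * q j)") auto
    qed simp
    also have "\<dots> = enn2ereal (\<Sum>j\<in>J. e2ennreal (- c j) * ennreal (p j) + ennreal (d j) * ennreal (q j))"
      by (simp add: t)
    finally show ?thesis .
  qed
  have int: "(\<integral>\<^sup>+\<omega>. ennreal (f \<omega>) \<partial>?U) = ennreal (event_expectation M A f)"
    if "integrable ?U f" "\<And>\<omega>. 0 \<le> f \<omega>" for f
    using that by (simp add: event_expectation_def nn_integral_eq_integral)
  let ?S = "\<lambda>\<omega>. \<Sum>j\<in>J. e2ennreal (- c j) * ennreal (D j \<omega>) + ennreal (d j) * ennreal (Y j \<omega>)"
  let ?f = "\<lambda>\<omega>. \<Sum>j\<in>J. ereal (D j \<omega>) * c j - ereal (d j * Y j \<omega>)"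
  have n: "- ?f \<omega> = enn2ereal (?S \<omega>)" for \<omega> using D Y by (intro neg) auto
  have f: "?f \<omega> = - enn2ereal (?S \<omega>)" for \<omega> using n[of \<omega>] by (metis ereal_uminus_uminus)
  have "(\<integral>\<^sup>+\<omega>. ?S \<omega> \<partial>?U) = (\<Sum>j\<in>J. e2ennreal (- c j) * (\<integral>\<^sup>+\<omega>. ennreal (D j \<omega>) \<partial>?U)
      + ennreal (d j) * (\<integral>\<^sup>+\<omega>. ennreal (Y j \<omega>) \<partial>?U))"
  proof -
    have [measurable]: "D j \<in> borel_measurable ?U" "Y j \<in> borel_measurable ?U" if "j \<in> J" for j
      using D(2) Y(2) that by blast+
    show ?thesis
      by (subst nn_integral_sum) (auto simp: nn_integral_add nn_integral_cmult intro!: sum.cong)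
  qed
  also have "\<dots> = (\<Sum>j\<in>J. e2ennreal (- c j) * ennreal (event_expectation M A (D j))
      + ennreal (d j) * ennreal (event_expectation M A (Y j)))"
    using D Y by (simp add: int)
  finally have "enn2ereal (\<integral>\<^sup>+\<omega>. ?S \<omega> \<partial>?U) =
      - (\<Sum>j\<in>J. ereal (event_expectation M A (D j)) * c j - ereal (d j * event_expectation M A (Y j)))"
    using D Y by (subst neg) (auto simp: event_expectation_def)
  moreover have "event_expectation_ereal M A ?f = - enn2ereal (\<integral>\<^sup>+\<omega>. ?S \<omega> \<partial>?U)"
    unfolding event_expectation_ereal_def n unfolding f
    by (simp add: e2ennreal_neg zero_ennreal.rep_eq)
  ultimately show ?thesis by simp
qed

section \<open>Independence of the subjects\<close>

text \<open>Independence is stated for whole paths on \<open>{0..}\<close>. Each path event is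
  therefore written as the preimage of a cylinder set \<open>A i\<close> of the product space, which
  requires nonnegative times.\<close>

lemma (in prob_space) prob_Inter_path_event:
  fixes X :: "nat \<Rightarrow> real \<Rightarrow> 'a \<Rightarrow> 'h"
  assumes "independent_processes M I X" "finite I" "I \<noteq> {}"
    and L: "\<And>i. i \<in> I \<Longrightarrow> fst ` set (L i) \<subseteq> {0..}"
  shows "prob (\<Inter>i\<in>I. path_event M (X i) (L i)) = (\<Prod>i\<in>I. prob (path_event M (X i) (L i)))"
proof -
  let ?N = "PiM {0..} (\<lambda>_. count_space UNIV) :: (real \<Rightarrow> 'h) measure"
  let ?Z = "\<lambda>i \<omega>. \<lambda>t\<in>{0..}. X i t \<omega>"
  define A where "A i = {f \<in> space ?N. \<forall>q\<in>set (L i). f (fst q) = snd q}" for i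
  have indep: "indep_vars (\<lambda>_. ?N) ?Z I"
    using assms(1) by (simp add: independent_processes_def)
  have A: "A i \<in> sets ?N" if "i \<in> I" for i
    unfolding A_def
  proof (rule sets.sets_Collect_finite_All)
    fix q assume "q \<in> set (L i)"
    then have "fst q \<in> {0..}" using L[OF that] by auto
    then have "(\<lambda>f. f (fst q)) -` {snd q} \<inter> space ?N \<in> sets ?N"
      by (intro measurable_sets[OF measurable_component_singleton]) auto
    then show "{f \<in> space ?N. f (fst q) = snd q} \<in> sets ?N"
      by (simp add: vimage_def Int_def conj_commute)
  qed simp_all
  have eq: "?Z i -` A i \<inter> space M = path_event M (X i) (L i)" if "i \<in> I" for i
    using L[OF that] by (auto simp: A_def path_event_def space_PiM PiE_def subset_iff image_subset_iff case_prod_unfold)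
  show ?thesis
    using indep_varsD[OF indep assms(3,2) subset_refl, of A] A eq by (simp cong: INF_cong prod.cong)
qed

text \<open>The other subjects contribute the same factor \<open>?R\<close> to numerator and
  denominator, nonzero by \<open>pos\<close>. Appending \<open>N\<close> to the list of subject
  \<open>i\<close> keeps the joint event in the form to which independence applies.\<close>

lemma prob_condition_one_subject:
  fixes X :: "nat \<Rightarrow> real \<Rightarrow> 'w \<Rightarrow> 'h"
  assumes "prob_space M" "independent_processes M I X" "finite I" "i \<in> I"
    and L: "\<And>i. i \<in> I \<Longrightarrow> fst ` set (L i) \<subseteq> {0..}" and N: "fst ` set N \<subseteq> {0..}"
    and pos: "measure M (\<Inter>i\<in>I. path_event M (X i) (L i)) > 0"
  shows "measure M (path_event M (X i) (L i)) > 0"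
    and "measure M ((\<Inter>i\<in>I. path_event M (X i) (L i)) \<inter> path_event M (X i) N)
        / measure M (\<Inter>i\<in>I. path_event M (X i) (L i)) =
      measure M (path_event M (X i) (L i @ N)) / measure M (path_event M (X i) (L i))"
proof -
  interpret prob_space M by fact
  let ?R = "\<Prod>j\<in>I - {i}. prob (path_event M (X j) (L j))"
  have ne: "I \<noteq> {}" using assms(4) by auto
  have den: "prob (\<Inter>i\<in>I. path_event M (X i) (L i)) = prob (path_event M (X i) (L i)) * ?R"
    using prob_Inter_path_event[OF assms(2,3) ne L] prod.remove[OF assms(3,4)] by simp
  show "measure M (path_event M (X i) (L i)) > 0"
    using pos measure_nonneg[of M "path_event M (X i) (L i)"] unfolding den
    by (auto simp: order_le_less)
  let ?L = "L(i := L i @ N)"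
  have "(\<Inter>i\<in>I. path_event M (X i) (L i)) \<inter> path_event M (X i) N =
      (\<Inter>j\<in>I. path_event M (X j) (?L j))"
    using assms(4) by (fastforce simp: path_event_def split: if_splits)
  also have "prob \<dots> = (\<Prod>j\<in>I. prob (path_event M (X j) (?L j)))"
    using L N assms(4) by (intro prob_Inter_path_event assms(2,3) ne) auto
  also have "\<dots> = prob (path_event M (X i) (L i @ N)) * ?R"
    by (subst prod.remove[OF assms(3,4)]) simp
  finally show "measure M ((\<Inter>i\<in>I. path_event M (X i) (L i)) \<inter> path_event M (X i) N)
        / measure M (\<Inter>i\<in>I. path_event M (X i) (L i)) =
      measure M (path_event M (X i) (L i @ N)) / measure M (path_event M (X i) (L i))"
    using pos unfolding den by auto
qed

section \<open>The product integral and left limits on the grid\<close>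

lemma time_grid_less_iff:
  assumes "time_grid K \<tau>" "i \<le> K" "j \<le> K"
  shows "\<tau> i < \<tau> j \<longleftrightarrow> i < j" and "\<tau> i \<le> \<tau> j \<longleftrightarrow> i \<le> j"
proof -
  have "strict_mono_on {0..K} \<tau>" using assms(1) by (simp add: time_grid_def)
  then show "\<tau> i < \<tau> j \<longleftrightarrow> i < j" "\<tau> i \<le> \<tau> j \<longleftrightarrow> i \<le> j"
    using assms(2,3) by (simp_all add: strict_mono_on_less strict_mono_on_less_eq)
qed

lemma time_grid_nonneg:
  assumes "time_grid K \<tau>"
  shows "\<tau> ` {0..K} \<subseteq> {0..}"
  using time_grid_less_iff(2)[OF assms, of 0] assms by (auto simp: time_grid_def)

lemma product_integral_refl: "product_integral K \<tau> \<alpha> t t = mat 1"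
proof -
  have "filter (\<lambda>k. t < \<tau> k \<and> \<tau> k \<le> t) [1..<Suc K] = []" by (auto simp: filter_empty_conv)
  then show ?thesis unfolding product_integral_def by (simp only: foldr.simps id_apply)
qed

text \<open>The bin contains the single jump time \<open>\<tau> k\<close>, so the product has one
  factor, and off the diagonal the identity adds nothing to it.\<close>

lemma product_integral_bin:
  assumes "time_grid K \<tau>" "k \<in> {1..K}" "g \<noteq> h"
  shows "product_integral K \<tau> \<alpha> (\<tau> (k - 1)) (\<tau> k) $ g $ h = \<alpha> k g h"
proof -
  have "filter (\<lambda>j. \<tau> (k - 1) < \<tau> j \<and> \<tau> j \<le> \<tau> k) [1..<Suc K] = filter (\<lambda>j. j = k) [1..<Suc K]"
    using assms(2) time_grid_less_iff[OF assms(1)] by (intro filter_cong refl) auto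
  also have "\<dots> = [k]"
  proof -
    have "[1..<Suc K] = [1..<k] @ k # [Suc k..<Suc K]"
      using assms(2) upt_add_eq_append[of 1 k "Suc K - k"] by (simp add: upt_conv_Cons del: upt_Suc)
    then show ?thesis by (simp add: filter_empty_conv del: upt_Suc)
  qed
  finally have "product_integral K \<tau> \<alpha> (\<tau> (k - 1)) (\<tau> k) = mat 1 + increment_matrix \<alpha> k"
    unfolding product_integral_def by (simp del: upt_Suc)
  then show ?thesis using assms(3) by (simp add: mat_def increment_matrix_def)
qed

text \<open>Moving \<open>s\<close> inside the open bin passes no jump time, so the product integral
  is constant in \<open>s\<close> just before \<open>\<tau> k\<close> and its limit is that
  constant.\<close>

lemma product_integral_left_eq:
  assumes "time_grid K \<tau>" "k \<in> {1..K}"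
  shows "product_integral_left K \<tau> \<alpha> (\<tau> k) t = product_integral K \<tau> \<alpha> (\<tau> (k - 1)) t"
proof -
  have less: "\<tau> (k - 1) < \<tau> k" using assms(2) time_grid_less_iff[OF assms(1)] by auto
  have "product_integral K \<tau> \<alpha> s t = product_integral K \<tau> \<alpha> (\<tau> (k - 1)) t"
    if s: "\<tau> (k - 1) < s" "s < \<tau> k" for s
  proof -
    have "s < \<tau> j \<longleftrightarrow> \<tau> (k - 1) < \<tau> j" if "j \<in> set [1..<Suc K]" for j
    proof (cases "j \<le> k - 1")
      case True
      then have "\<tau> j \<le> \<tau> (k - 1)" using assms(2) time_grid_less_iff[OF assms(1)] by auto
      with s show ?thesis by auto
    next
      case False
      then have "\<tau> k \<le> \<tau> j" using that assms(2) time_grid_less_iff[OF assms(1)] by auto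
      with s less show ?thesis by auto
    qed
    then have "filter (\<lambda>j. s < \<tau> j \<and> \<tau> j \<le> t) [1..<Suc K] =
        filter (\<lambda>j. \<tau> (k - 1) < \<tau> j \<and> \<tau> j \<le> t) [1..<Suc K]"
      by (intro filter_cong) auto
    then show ?thesis unfolding product_integral_def by simp
  qed
  then have "\<forall>\<^sub>F s in at_left (\<tau> k).
      product_integral K \<tau> \<alpha> s t = product_integral K \<tau> \<alpha> (\<tau> (k - 1)) t"
    using less eventually_at_left by blast
  then show ?thesis
    unfolding product_integral_left_def by (intro tendsto_Lim tendsto_eventually) auto
qed

text \<open>The path is constant on the bin up to its right end, and
  \<open>at_left (\<tau> k)\<close> is a nontrivial filter, so the value chosen by
  \<open>THE\<close> is unique.\<close>

lemma state_before_eq: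
  assumes "time_grid K \<tau>" "k \<in> {1..K}" "grid_step_path K \<tau> (\<lambda>t. X t \<omega>)"
  shows "state_before X (\<tau> k) \<omega> = X (\<tau> (k - 1)) \<omega>"
proof -
  have less: "\<tau> (k - 1) < \<tau> k" using assms(2) time_grid_less_iff[OF assms(1)] by auto
  have "X s \<omega> = X (\<tau> (k - 1)) \<omega>" if "\<tau> (k - 1) < s" "s < \<tau> k" for s
    using assms(2,3) that unfolding grid_step_path_def by (auto dest!: spec[of _ "k - 1"] spec[of _ s])
  then have ev: "\<forall>\<^sub>F s in at_left (\<tau> k). X s \<omega> = X (\<tau> (k - 1)) \<omega>"
    using less eventually_at_left by blast
  show ?thesis unfolding state_before_def
  proof (rule the_equality)
    fix h assume "\<forall>\<^sub>F s in at_left (\<tau> k). X s \<omega> = h"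
    with ev have "\<forall>\<^sub>F s in at_left (\<tau> k). h = X (\<tau> (k - 1)) \<omega>" by eventually_elim simp
    then show "h = X (\<tau> (k - 1)) \<omega>" by (simp add: eventually_const)
  qed (rule ev)
qed

section \<open>The visits around a bin and conditioning on them\<close>

lemma visit_state_visit:
  assumes "strict_mono_on {0..m} v" "j \<le> m"
  shows "visit_state m v x (v j) = x j"
proof -
  have "(THE i. i \<le> m \<and> v i = v j) = j"
    using assms by (intro the_equality) (auto dest!: strict_mono_on_imp_inj_on inj_onD)
  then show ?thesis by (simp add: visit_state_def)
qed

text \<open>Visits happen at grid times, hence never strictly inside the bin. The last visit before
  the bin and the first one after it are therefore consecutive.\<close>

lemma visits_around_bin:
  assumes "time_grid K \<tau>" "visit_scheme K \<tau> m v" "k \<in> {1..K}"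
    and obs: "{\<tau> (k - 1)<..\<tau> k} \<subseteq> {v 0<..v m}"
  obtains j where "j < m" "v j \<le> \<tau> (k - 1)" "\<tau> k \<le> v (Suc j)"
    "last_visit m v (\<tau> (k - 1)) = v j" "next_visit m v (\<tau> k) = v (Suc j)"
proof -
  note iff = time_grid_less_iff[OF assms(1)]
  have v: "strict_mono_on {0..m} v" "\<And>i. i \<le> m \<Longrightarrow> v i \<in> \<tau> ` {0..K}"
    using assms(2) by (auto simp: visit_scheme_def)
  have less: "\<tau> (k - 1) < \<tau> k" using assms(3) iff by auto
  have grid: "v i \<le> \<tau> (k - 1) \<or> \<tau> k \<le> v i" if i: "i \<le> m" for i
  proof -
    obtain p where p: "p \<le> K" "v i = \<tau> p" using v(2)[OF i] by auto
    show ?thesis using assms(3) p(1) by (cases "p \<le> k - 1") (auto simp: p(2) iff)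
  qed
  have "\<tau> k \<in> {v 0<..v m}" using obs less by auto
  then have vk: "v 0 < \<tau> k" "\<tau> k \<le> v m" by auto
  \<comment> \<open>The maximum below exists because \<open>v 0 < \<tau> k\<close>, which by the
    dichotomy \<open>grid\<close> means \<open>0 \<in> J\<close>.\<close>
  define J where "J = {i. i \<le> m \<and> v i \<le> \<tau> (k - 1)}"
  have J: "finite J" "0 \<in> J" using grid[of 0] vk by (auto simp: J_def)
  define j where "j = Max J"
  have "j \<in> J" unfolding j_def using J by (intro Max_in) auto
  then have j: "j \<le> m" "v j \<le> \<tau> (k - 1)" by (auto simp: J_def)
  \<comment> \<open>Were \<open>j\<close> the last index, \<open>\<tau> k \<le> v m\<close> would
    contradict \<open>v j \<le> \<tau> (k - 1)\<close>.\<close>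
  have "j \<noteq> m" using j vk less by auto
  with j have jm: "j < m" by simp
  have "Suc j \<notin> J" using J(1) Max_ge[of J "Suc j"] unfolding j_def by linarith
  then have Sj: "\<tau> k \<le> v (Suc j)" using grid[of "Suc j"] jm by (auto simp: J_def)
  have le: "v p \<le> v q" if "p \<le> q" "q \<le> m" for p q
    using v(1) that by (auto simp: strict_mono_on_less_eq)
  have "last_visit m v (\<tau> (k - 1)) = v j"
    unfolding last_visit_def
  proof (rule Max_eqI)
    fix y assume "y \<in> {v i |i. i \<le> m \<and> v i \<le> \<tau> (k - 1)}"
    then obtain i where "y = v i" "i \<in> J" by (auto simp: J_def)
    then show "y \<le> v j" using J j le unfolding j_def by auto
  qed (use j in auto)
  moreover have "next_visit m v (\<tau> k) = v (Suc j)"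
    unfolding next_visit_def
  proof (rule Min_eqI)
    fix y assume "y \<in> {v i |i. i \<le> m \<and> \<tau> k \<le> v i}"
    then obtain i where i: "y = v i" "i \<le> m" "\<tau> k \<le> v i" by auto
    then have "\<not> i \<le> j" using le[of i j] j less by auto
    then show "v (Suc j) \<le> y" using i le by auto
  qed (use jm Sj in auto)
  ultimately show ?thesis using that jm j(2) Sj by blast
qed

text \<open>\<open>N\<close> prescribes states at the ends of the bin, so both counts are served:
  one entry at \<open>\<tau> (k - 1)\<close> describes being at risk, and entries at both ends
  describe a transition.\<close>

lemma prob_bin_path_given_visits:
  fixes X :: "nat \<Rightarrow> real \<Rightarrow> 'w \<Rightarrow> 'h::finite"
  assumes grid: "time_grid K \<tau>" and P: "P = product_integral K \<tau> \<alpha>"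
    and M: "prob_space M" "independent_processes M {1..n} X"
    and mk: "\<forall>i\<in>{1..n}. markov_process M (X i)" "\<forall>i\<in>{1..n}. has_grid_transitions M K \<tau> P (X i)"
    and vs: "\<forall>i\<in>{1..n}. visit_scheme K \<tau> (m i) (v i)"
    and Obs: "Obs = observed_event M n m v x X" and pos: "measure M Obs > 0"
    and k: "k \<in> {1..K}" and i: "i \<in> under_observation \<tau> n m v k"
    and lr: "l = last_visit (m i) (v i) (\<tau> (k - 1))" "r = next_visit (m i) (v i) (\<tau> k)"
    and N: "sorted (map fst N)" "fst ` set N \<subseteq> {\<tau> (k - 1), \<tau> k}"
  shows "measure M (Obs \<inter> path_event M (X i) N) / measure M Obs =
    path_weight P ((l, visit_state (m i) (v i) (x i) l) # N @ [(r, visit_state (m i) (v i) (x i) r)])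
      / P l r $ visit_state (m i) (v i) (x i) l $ visit_state (m i) (v i) (x i) r"
proof -
  note iff = time_grid_less_iff[OF grid]
  have i': "i \<in> {1..n}" "{\<tau> (k - 1)<..\<tau> k} \<subseteq> {v i 0<..v i (m i)}"
    using i by (auto simp: under_observation_def)
  have vi: "visit_scheme K \<tau> (m i) (v i)" using vs i'(1) by auto
  obtain j where j: "j < m i" "v i j \<le> \<tau> (k - 1)" "\<tau> k \<le> v i (Suc j)"
    and l: "l = v i j" and r: "r = v i (Suc j)"
    using visits_around_bin[OF grid vi k i'(2)] lr by metis
  have smv: "strict_mono_on {0..m i} (v i)" using vi by (simp add: visit_scheme_def)
  define L where "L i = map (\<lambda>j. (v i j, x i j)) [0..<Suc (m i)]" for i
  have Lgrid: "fst ` set (L i) \<subseteq> \<tau> ` {0..K}" if "i \<in> {1..n}" for i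
    using vs that by (fastforce simp: L_def visit_scheme_def)
  have Ngrid: "fst ` set N \<subseteq> \<tau> ` {0..K}" using N(2) k by force
  \<comment> \<open>The index set contains \<open>i\<close>, so the intersection is not the default
    \<open>UNIV\<close> of an empty family and stays inside \<open>space M\<close>.\<close>
  have Obs': "Obs = (\<Inter>i\<in>{1..n}. path_event M (X i) (L i))"
    using i'(1) unfolding Obs observed_event_def path_event_def L_def
    by (auto simp: less_Suc_eq_le simp del: upt_Suc)
  let ?f = "\<lambda>j. (v i j, x i j)"
  define L1 where "L1 = map ?f [0..<j]"
  define L2 where "L2 = map ?f [Suc (Suc j)..<Suc (m i)]"
  have "[0..<Suc (m i)] = [0..<j] @ j # Suc j # [Suc (Suc j)..<Suc (m i)]"
    using j(1) upt_add_eq_append[of 0 j "Suc (m i) - j"] by (simp add: upt_conv_Cons del: upt_Suc)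
  then have Li: "L i = L1 @ ?f j # ?f (Suc j) # L2"
    by (simp add: L_def L1_def L2_def del: upt_Suc)
  have sortL: "sorted (map fst (L i))"
  proof -
    have "map fst (L i) = map (v i) [0..<Suc (m i)]" by (simp add: L_def del: upt_Suc)
    moreover have "sorted_wrt (\<lambda>p q. v i p \<le> v i q) [0..<Suc (m i)]"
      using smv by (auto simp: sorted_wrt_iff_nth_less strict_mono_on_less_eq simp del: upt_Suc)
    ultimately show ?thesis by (simp add: sorted_map del: upt_Suc)
  qed
  have less: "\<tau> (k - 1) \<le> \<tau> k" using k iff by auto
  \<comment> \<open>The sorting is not strict: the bin ends may coincide with the visits at
    \<open>j\<close> and \<open>Suc j\<close>.\<close>
  have sortN: "sorted (map fst (L1 @ ?f j # N @ ?f (Suc j) # L2))"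
    using sortL N j less unfolding Li by (fastforce simp: sorted_append)
  have gridN: "fst ` set (L1 @ ?f j # N @ ?f (Suc j) # L2) \<subseteq> \<tau> ` {0..K}"
    using Lgrid[OF i'(1)] Ngrid unfolding Li by auto
  have nonneg: "\<tau> ` {0..K} \<subseteq> {0..}" using time_grid_nonneg[OF grid] .
  have one: "measure M (path_event M (X i) (L i)) > 0"
    "measure M (Obs \<inter> path_event M (X i) N) / measure M Obs =
      measure M (path_event M (X i) (L i @ N)) / measure M (path_event M (X i) (L i))"
    unfolding Obs'
    by (rule prob_condition_one_subject[where L=L, OF M finite_atLeastAtMost i'(1)
          order_trans[OF Lgrid nonneg] order_trans[OF Ngrid nonneg] pos[unfolded Obs']]; assumption)+
  \<comment> \<open>Appended entries may be moved to their place in time, because the event ignores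
    the order of its list.\<close>
  have "path_event M (X i) (L i @ N) = path_event M (X i) (L1 @ ?f j # N @ ?f (Suc j) # L2)"
    unfolding Li path_event_def by (simp add: ball_Un conj_ac)
  then have "measure M (Obs \<inter> path_event M (X i) N) / measure M Obs =
      path_weight P (?f j # N @ [?f (Suc j)]) / path_weight P [?f j, ?f (Suc j)]"
    using one prob_path_event_insert[OF M(1) _ _ _ nonneg sortN gridN, of "X i" P]
      mk i'(1) by (simp add: Li P product_integral_refl)
  moreover have "visit_state (m i) (v i) (x i) l = x i j" "visit_state (m i) (v i) (x i) r = x i (Suc j)"
    unfolding l r using j(1) by (auto intro!: visit_state_visit[OF smv])
  ultimately show ?thesis by (simp add: l r)
qed

section \<open>Expected log-likelihood and expected counts\<close>

theorem proposition1:
  fixes V :: "('h::finite \<times> 'h) set"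
    and K n :: nat
    and \<tau> :: "nat \<Rightarrow> real"
    and \<alpha>t :: "nat \<Rightarrow> 'h \<Rightarrow> 'h \<Rightarrow> real"
    and M :: "'w measure"
    and X :: "nat \<Rightarrow> real \<Rightarrow> 'w \<Rightarrow> 'h"
    and m :: "nat \<Rightarrow> nat"
    and v :: "nat \<Rightarrow> nat \<Rightarrow> real"
    and x :: "nat \<Rightarrow> nat \<Rightarrow> 'h"
    and P Pl :: "real \<Rightarrow> real \<Rightarrow> real^'h^'h"
    and Obs :: "'w set"
    and l r :: "nat \<Rightarrow> nat \<Rightarrow> real"
    and a b :: "nat \<Rightarrow> nat \<Rightarrow> 'h"
  assumes "\<forall>(g, h)\<in>V. g \<noteq> h" and "acyclic V"
    and "time_grid K \<tau>"
    and "intensity_array K V \<alpha>t"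
    and P: "P = product_integral K \<tau> \<alpha>t"
    and Pl: "Pl = product_integral_left K \<tau> \<alpha>t"
    and "prob_space M"
    and "independent_processes M {1..n} X"
    and "\<forall>i\<in>{1..n}. markov_process M (X i)"
    and "\<forall>i\<in>{1..n}. \<forall>\<omega>\<in>space M. grid_step_path K \<tau> (\<lambda>t. X i t \<omega>)"
    and "\<forall>i\<in>{1..n}. has_grid_transitions M K \<tau> P (X i)"
    and "\<forall>i\<in>{1..n}. visit_scheme K \<tau> (m i) (v i)"
    and Obs: "Obs = observed_event M n m v x X"
    and "measure M Obs > 0"
    and l: "\<And>i k. l i k = last_visit (m i) (v i) (\<tau> (k - 1))"
    and r: "\<And>i k. r i k = next_visit (m i) (v i) (\<tau> k)"
    and a: "\<And>i k. a i k = visit_state (m i) (v i) (x i) (l i k)"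
    and b: "\<And>i k. b i k = visit_state (m i) (v i) (x i) (r i k)"
  shows
    "(\<forall>\<alpha>. intensity_array K V \<alpha> \<longrightarrow>
        event_expectation_ereal M Obs (complete_log_likelihood K V \<tau> n m v X \<alpha>) =
        (\<Sum>k\<in>{1..K}. \<Sum>(g, h)\<in>V.
           ereal (event_expectation M Obs (transition_count \<tau> n m v X k g h)) * log_ereal (\<alpha> k g h)
             - ereal (\<alpha> k g h * event_expectation M Obs (at_risk_count \<tau> n m v X k g))))
     \<and> (\<forall>k\<in>{1..K}. \<forall>(g, h)\<in>V.
        event_expectation M Obs (transition_count \<tau> n m v X k g h) =
          (\<Sum>i\<in>under_observation \<tau> n m v k.
             P (l i k) (\<tau> (k - 1)) $ a i k $ g * \<alpha>t k g h * P (\<tau> k) (r i k) $ h $ b i k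
               / P (l i k) (r i k) $ a i k $ b i k)
        \<and> event_expectation M Obs (at_risk_count \<tau> n m v X k g) =
          (\<Sum>i\<in>under_observation \<tau> n m v k.
             P (l i k) (\<tau> (k - 1)) $ a i k $ g * Pl (\<tau> k) (r i k) $ g $ b i k
               / P (l i k) (r i k) $ a i k $ b i k))
     \<and> (\<forall>k\<in>{1..K}. \<forall>t\<ge>\<tau> k. \<forall>g h. Pl (\<tau> k) t $ g $ h = P (\<tau> (k - 1)) t $ g $ h)"
proof (intro conjI)
  interpret prob_space M by fact
  note grid = \<open>time_grid K \<tau>\<close>
  note nonneg = time_grid_nonneg[OF grid]
  have X: "X i t \<in> measurable M (count_space UNIV)" if "i \<in> {1..n}" "0 \<le> t" for i t
    using assms(9) that by (simp add: markov_process_def)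
  have before: "state_before (X i) (\<tau> k) \<omega> = X i (\<tau> (k - 1)) \<omega>"
    if "i \<in> {1..n}" "k \<in> {1..K}" "\<omega> \<in> space M" for i k \<omega>
    using that assms(10) by (intro state_before_eq[OF grid]) auto
  have sub: "i \<in> {1..n}" if "i \<in> under_observation \<tau> n m v k" for i k
    using that by (simp add: under_observation_def)
  \<comment> \<open>Under-observation counts become path events on grid times, with the left limit
    replaced by the state at \<open>\<tau> (k - 1)\<close>.\<close>
  have trans: "{\<omega> \<in> space M. state_before (X i) (\<tau> k) \<omega> = g \<and> X i (\<tau> k) \<omega> = h} =
      path_event M (X i) [(\<tau> (k - 1), g), (\<tau> k, h)]"
    if "i \<in> under_observation \<tau> n m v k" "k \<in> {1..K}" for i k g h
    using before[OF sub] that by (auto simp: path_event_def)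
  have risk: "{\<omega> \<in> space M. state_before (X i) (\<tau> k) \<omega> = g} =
      path_event M (X i) [(\<tau> (k - 1), g)]"
    if "i \<in> under_observation \<tau> n m v k" "k \<in> {1..K}" for i k g
    using before[OF sub] that by (auto simp: path_event_def)
  have times: "0 \<le> \<tau> (k - 1)" "0 \<le> \<tau> k" if "k \<in> {1..K}" for k
    using nonneg that by (auto simp: image_subset_iff)
  have sets: "{\<omega> \<in> space M. state_before (X i) (\<tau> k) \<omega> = g \<and> X i (\<tau> k) \<omega> = h} \<in> events"
    "{\<omega> \<in> space M. state_before (X i) (\<tau> k) \<omega> = g} \<in> events"
    if "i \<in> under_observation \<tau> n m v k" "k \<in> {1..K}" for i k g h
    unfolding trans[OF that] risk[OF that] using X[OF sub[OF that(1)]] times[OF that(2)]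
    by (auto intro!: path_event_sets)
  have ObsM: "Obs \<in> events"
  proof -
    have "{\<omega> \<in> space M. X i (v i j) \<omega> = x i j} \<in> events" if "i \<in> {1..n}" "j \<le> m i" for i j
    proof -
      have "v i j \<in> \<tau> ` {0..K}" using assms(12) that by (auto simp: visit_scheme_def image_subset_iff)
      then have "path_event M (X i) [(v i j, x i j)] \<in> events"
        using X[OF that(1)] nonneg by (intro path_event_sets) auto
      then show ?thesis by (simp add: path_event_def)
    qed
    then have "{\<omega> \<in> space M. \<forall>i\<in>{1..n}. \<forall>j\<in>{..m i}. X i (v i j) \<omega> = x i j} \<in> events"
      by (intro sets.sets_Collect_finite_All) auto
    then show ?thesis unfolding Obs observed_event_def by (simp only: Ball_def atMost_iff)
  qed
  have U: "finite_measure (uniform_measure M Obs)"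
    using \<open>measure M Obs > 0\<close>
    by (intro prob_space.finite_measure prob_space_uniform_measure) (auto simp: emeasure_eq_measure)
  show "\<forall>\<alpha>. intensity_array K V \<alpha> \<longrightarrow>
        event_expectation_ereal M Obs (complete_log_likelihood K V \<tau> n m v X \<alpha>) =
        (\<Sum>k\<in>{1..K}. \<Sum>(g, h)\<in>V.
           ereal (event_expectation M Obs (transition_count \<tau> n m v X k g h)) * log_ereal (\<alpha> k g h)
             - ereal (\<alpha> k g h * event_expectation M Obs (at_risk_count \<tau> n m v X k g)))"
  proof (intro allI impI)
    fix \<alpha> :: "nat \<Rightarrow> 'h \<Rightarrow> 'h \<Rightarrow> real" assume \<alpha>: "intensity_array K V \<alpha>"
    \<comment> \<open>The double sum is flattened to one sum over triples in
      \<open>{1..K} \<times> V\<close>, with \<open>at_risk_count\<close> repeated for every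
      \<open>h\<close>.\<close>
    let ?D = "\<lambda>(k, g, h). transition_count \<tau> n m v X k g h"
    let ?Y = "\<lambda>(k, g, h). at_risk_count \<tau> n m v X k g"
    let ?c = "\<lambda>(k, g, h). log_ereal (\<alpha> k g h)" and ?d = "\<lambda>(k, g, h). \<alpha> k g h"
    \<comment> \<open>The bound by 1 makes \<open>log_ereal\<close> nonpositive. It holds because an
      entry of a nonnegative row is at most the row sum.\<close>
    have \<alpha>01: "0 \<le> \<alpha> k g h" "\<alpha> k g h \<le> 1" if "k \<in> {1..K}" "(g, h) \<in> V" for k g h
    proof -
      have "g \<noteq> h" using assms(1) that(2) by auto
      then have *: "0 \<le> \<alpha> k g h'" if "h' \<in> UNIV - {g}" for h'
        using \<alpha> \<open>k \<in> {1..K}\<close> that by (auto simp: intensity_array_def)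
      show "0 \<le> \<alpha> k g h" using * \<open>g \<noteq> h\<close> by auto
      have "\<alpha> k g h \<le> (\<Sum>h'\<in>UNIV - {g}. \<alpha> k g h')"
        using * \<open>g \<noteq> h\<close> by (intro member_le_sum) auto
      also have "\<dots> \<le> 1" using \<alpha> that(1) by (auto simp: intensity_array_def)
      finally show "\<alpha> k g h \<le> 1" .
    qed
    have int: "integrable (uniform_measure M Obs) (transition_count \<tau> n m v X k g h)"
      "integrable (uniform_measure M Obs) (at_risk_count \<tau> n m v X k g)" if "k \<in> {1..K}" for k g h
      unfolding transition_count_def[abs_def] at_risk_count_def[abs_def]
      using sets that by (auto intro!: integrable_sum_of_bool[OF U])
    have "event_expectation_ereal M Obs
          (\<lambda>\<omega>. \<Sum>j\<in>{1..K} \<times> V. ereal (?D j \<omega>) * ?c j - ereal (?d j * ?Y j \<omega>)) =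
        (\<Sum>j\<in>{1..K} \<times> V. ereal (event_expectation M Obs (?D j)) * ?c j
          - ereal (?d j * event_expectation M Obs (?Y j)))"
    proof (rule event_expectation_ereal_nonpos_sum)
      show "?c j \<le> 0" "0 \<le> ?d j" if "j \<in> {1..K} \<times> V" for j
        using that \<alpha>01 by (force simp: log_ereal_def)+
      show "0 \<le> ?D j \<omega>" "0 \<le> ?Y j \<omega>" for j \<omega>
        by (auto simp: transition_count_def at_risk_count_def intro!: sum_nonneg split: prod.split)
      show "integrable (uniform_measure M Obs) (?D j)" "integrable (uniform_measure M Obs) (?Y j)"
        if "j \<in> {1..K} \<times> V" for j
        using that int by auto
    qed (use \<open>prob_space M\<close> ObsM \<open>measure M Obs > 0\<close> in auto)
    then show "event_expectation_ereal M Obs (complete_log_likelihood K V \<tau> n m v X \<alpha>) =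
        (\<Sum>k\<in>{1..K}. \<Sum>(g, h)\<in>V.
           ereal (event_expectation M Obs (transition_count \<tau> n m v X k g h)) * log_ereal (\<alpha> k g h)
             - ereal (\<alpha> k g h * event_expectation M Obs (at_risk_count \<tau> n m v X k g)))"
      unfolding complete_log_likelihood_def[abs_def] sum.cartesian_product
      by (simp add: case_prod_unfold)
  qed
  have cond: "measure M (Obs \<inter> path_event M (X i) N) / measure M Obs =
      path_weight P ((l i k, a i k) # N @ [(r i k, b i k)]) / P (l i k) (r i k) $ a i k $ b i k"
    if "i \<in> under_observation \<tau> n m v k" "k \<in> {1..K}"
      "sorted (map fst N)" "fst ` set N \<subseteq> {\<tau> (k - 1), \<tau> k}" for i k N
    unfolding a b
    by (rule prob_bin_path_given_visits[OF grid P assms(7,8,9,11,12) Obs assms(14) that(2,1) l r that(3,4)])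
  show "\<forall>k\<in>{1..K}. \<forall>(g, h)\<in>V.
        event_expectation M Obs (transition_count \<tau> n m v X k g h) =
          (\<Sum>i\<in>under_observation \<tau> n m v k.
             P (l i k) (\<tau> (k - 1)) $ a i k $ g * \<alpha>t k g h * P (\<tau> k) (r i k) $ h $ b i k
               / P (l i k) (r i k) $ a i k $ b i k)
        \<and> event_expectation M Obs (at_risk_count \<tau> n m v X k g) =
          (\<Sum>i\<in>under_observation \<tau> n m v k.
             P (l i k) (\<tau> (k - 1)) $ a i k $ g * Pl (\<tau> k) (r i k) $ g $ b i k
               / P (l i k) (r i k) $ a i k $ b i k)"
  proof (intro ballI, clarify, intro conjI)
    fix k g h assume k: "k \<in> {1..K}" and gh: "(g, h) \<in> V"
    have le: "\<tau> (k - 1) \<le> \<tau> k" using k time_grid_less_iff[OF grid] by auto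
    \<comment> \<open>Two inserted points split the passage from \<open>l i k\<close> to
      \<open>r i k\<close> into three factors; the middle one crosses the bin and is the jump
      itself.\<close>
    have k_inc: "P (\<tau> (k - 1)) (\<tau> k) $ g $ h = \<alpha>t k g h"
      unfolding P using assms(1) gh by (intro product_integral_bin[OF grid k]) auto
    have "event_expectation M Obs (transition_count \<tau> n m v X k g h) =
          (\<Sum>i\<in>under_observation \<tau> n m v k.
             prob (Obs \<inter> {\<omega> \<in> space M. state_before (X i) (\<tau> k) \<omega> = g \<and> X i (\<tau> k) \<omega> = h}) / prob Obs)"
      unfolding transition_count_def[abs_def]
      by (rule event_expectation_sum_of_bool[OF assms(7) ObsM assms(14) sets(1)[OF _ k]])
    also have "\<dots> =
          (\<Sum>i\<in>under_observation \<tau> n m v k.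
             P (l i k) (\<tau> (k - 1)) $ a i k $ g * \<alpha>t k g h * P (\<tau> k) (r i k) $ h $ b i k
               / P (l i k) (r i k) $ a i k $ b i k)"
      by (intro sum.cong refl) (simp add: trans[OF _ k] cond[OF _ k] le k_inc del: One_nat_def)
    finally show "event_expectation M Obs (transition_count \<tau> n m v X k g h) =
          (\<Sum>i\<in>under_observation \<tau> n m v k.
             P (l i k) (\<tau> (k - 1)) $ a i k $ g * \<alpha>t k g h * P (\<tau> k) (r i k) $ h $ b i k
               / P (l i k) (r i k) $ a i k $ b i k)" .
    \<comment> \<open>With a single inserted point only two factors arise, and the second, starting
      at \<open>\<tau> (k - 1)\<close>, is the left limit at \<open>\<tau> k\<close>.\<close>
    have left: "Pl (\<tau> k) t = P (\<tau> (k - 1)) t" for t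
      unfolding P Pl by (rule product_integral_left_eq[OF grid k])
    have "event_expectation M Obs (at_risk_count \<tau> n m v X k g) =
          (\<Sum>i\<in>under_observation \<tau> n m v k.
             prob (Obs \<inter> {\<omega> \<in> space M. state_before (X i) (\<tau> k) \<omega> = g}) / prob Obs)"
      unfolding at_risk_count_def[abs_def]
      by (rule event_expectation_sum_of_bool[OF assms(7) ObsM assms(14) sets(2)[OF _ k]])
    also have "\<dots> =
          (\<Sum>i\<in>under_observation \<tau> n m v k.
             P (l i k) (\<tau> (k - 1)) $ a i k $ g * Pl (\<tau> k) (r i k) $ g $ b i k
               / P (l i k) (r i k) $ a i k $ b i k)"
      by (intro sum.cong refl) (simp add: risk[OF _ k] cond[OF _ k] left del: One_nat_def)
    finally show "event_expectation M Obs (at_risk_count \<tau> n m v X k g) =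
          (\<Sum>i\<in>under_observation \<tau> n m v k.
             P (l i k) (\<tau> (k - 1)) $ a i k $ g * Pl (\<tau> k) (r i k) $ g $ b i k
               / P (l i k) (r i k) $ a i k $ b i k)" .
  qed
  show "\<forall>k\<in>{1..K}. \<forall>t\<ge>\<tau> k. \<forall>g h. Pl (\<tau> k) t $ g $ h = P (\<tau> (k - 1)) t $ g $ h"
    unfolding P Pl by (simp add: product_integral_left_eq[OF grid] del: One_nat_def)

qed

end
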